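(* Let $f\in\mathcal{C}$ and let $F$ be the inverse of $f$ near the origin. Then $$|\Gamma_n(F)|\le\frac{1}{2n}\quad\text{for } n=1,2,3.$$ The estimates are sharp for the function $l(z)=z/(1-z)$.
   Context: Let $\mathbb{D}=\{z\in\mathbb{C}:|z|<1\}$ and let $\mathcal{A}$ be the class of analytic functions $f$ in $\mathbb{D}$ with $f(z)=z+\sum_{n\ge2}a_nz^n$. The class of (normalized) convex functions is $\mathcal{C}=\left\{f\in\mathcal{A}:\ \mathrm{Re}\left(1+\frac{zf''(z)}{f'(z)}\right)>0,\ z\in\mathbb{D}\right\}$. If $F(w)=f^{-1}(w)=w+\sum_{n\ge2}A_nw^n$ is the inverse of $f$ near $0$, the logarithmic inverse coefficients $\Gamma_n(F)$ are defined by $\log\left(F(w)/w\right)=2\sum_{n=1}^\infty\Gamma_n(F)w^n$ near $w=0$ (branch with value $0$ at $w=0$). *)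

theory Defs
  imports "HOL-Complex_Analysis.Complex_Analysis"
begin

definition normalized_analytic :: "(complex \<Rightarrow> complex) set"
  where "normalized_analytic =
    {f. f holomorphic_on ball 0 1 \<and> f 0 = 0 \<and> deriv f 0 = 1}"

text \<open>
  The condition \<open>deriv f z \<noteq> 0\<close> makes explicit that the quotient is defined at every point of the
  disc. It cannot be left out, since division by zero yields zero in HOL.
\<close>

definition convex_class :: "(complex \<Rightarrow> complex) set"
  where "convex_class =
    {f \<in> normalized_analytic. \<forall>z \<in> ball 0 1.
       deriv f z \<noteq> 0 \<and> Re (1 + z * deriv (deriv f) z / deriv f z) > 0}"

text \<open>
  The inverse near the origin is only determined as a germ, so it is a relation between
  functions.
\<close>

definition inverse_near_0 :: "(complex \<Rightarrow> complex) \<Rightarrow> (complex \<Rightarrow> complex) \<Rightarrow> bool"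
  where "inverse_near_0 f F \<longleftrightarrow>
    F analytic_on {0} \<and> F 0 = 0 \<and>
    (\<forall>\<^sub>F w in nhds 0. f (F w) = w) \<and> (\<forall>\<^sub>F z in nhds 0. F (f z) = z)"

text \<open>
  The logarithm of \<open>F w / w\<close>, with the removable singularity at the origin filled in by
  \<open>deriv F 0 = 1\<close>. The principal branch \<open>Ln\<close> is analytic near \<open>1\<close> with \<open>Ln 1 = 0\<close>, so it is the
  required branch near the origin.
\<close>

definition log_quotient :: "(complex \<Rightarrow> complex) \<Rightarrow> complex \<Rightarrow> complex"
  where "log_quotient F w = Ln (if w = 0 then 1 else F w / w)"

definition log_inverse_coeff :: "(complex \<Rightarrow> complex) \<Rightarrow> nat \<Rightarrow> complex"
  where "log_inverse_coeff F n = fps_nth (fps_expansion (log_quotient F) 0) n / 2"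

lemma inverse_near_0_exists:
  assumes "f \<in> normalized_analytic"
  shows "\<exists>F. inverse_near_0 f F"
proof -
  have hol: "f holomorphic_on ball 0 1" and f0: "f 0 = 0" and d0: "deriv f 0 \<noteq> 0"
    using assms by (auto simp: normalized_analytic_def)
  obtain r where r: "r > 0" "ball (0::complex) r \<subseteq> ball 0 1" "open (f ` ball 0 r)" "inj_on f (ball 0 r)"
    using has_complex_derivative_locally_invertible[OF hol _ open_ball d0] by auto
  have hol': "f holomorphic_on ball 0 r"
    using hol r(2) holomorphic_on_subset by blast
  obtain F where F: "F holomorphic_on (f ` ball 0 r)" "\<And>z. z \<in> ball 0 r \<Longrightarrow> F (f z) = z"
    by (rule holomorphic_has_inverse[OF hol' open_ball r(4)], rule that)
  have mem: "0 \<in> f ` ball 0 r"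
    using r(1) f0 by (metis centre_in_ball imageI)
  have "F analytic_on {0}"
    unfolding analytic_at using F(1) r(3) mem by (intro exI[of _ "f ` ball 0 r"]) simp
  moreover have "F 0 = 0"
    using F(2)[of 0] f0 r(1) by simp
  moreover have "\<forall>\<^sub>F w in nhds 0. f (F w) = w"
    using eventually_nhds_in_open[OF r(3) mem] by eventually_elim (use F(2) in auto)
  moreover have "\<forall>\<^sub>F z in nhds 0. F (f z) = z"
    using eventually_nhds_in_open[of "ball 0 r" 0] r(1) F(2)
    by (auto elim!: eventually_mono)
  ultimately show ?thesis
    unfolding inverse_near_0_def by blast
qed

lemma deriv_inverse_near_0:
  assumes f: "f \<in> normalized_analytic" and F: "inverse_near_0 f F"
  shows "deriv F 0 = 1"
proof -
  have Fa: "F analytic_on {0}" "F 0 = 0" and ev: "\<forall>\<^sub>F w in nhds 0. f (F w) = w"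
    using F by (auto simp: inverse_near_0_def)
  have "f holomorphic_on ball 0 1"
    using f by (simp add: normalized_analytic_def)
  then have "f field_differentiable at (F 0)"
    using Fa(2) by (simp add: holomorphic_on_imp_differentiable_at)
  then have "deriv (f \<circ> F) 0 = deriv f (F 0) * deriv F 0"
    using Fa(1) analytic_on_imp_differentiable_at by (intro deriv_chain) auto
  moreover have "deriv (f \<circ> F) 0 = deriv (\<lambda>w. w) 0"
    by (intro deriv_cong_ev) (use ev in \<open>auto simp: o_def\<close>)
  ultimately show ?thesis
    using f Fa(2) by (simp add: normalized_analytic_def)
qed

lemma log_inverse_coeff_sums:
  assumes f: "f \<in> normalized_analytic" and F: "inverse_near_0 f F"
  shows "\<forall>\<^sub>F w in at 0. (\<lambda>n. 2 * log_inverse_coeff F (Suc n) * w ^ Suc n) sums Ln (F w / w)"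
proof -
  define g where "g = (\<lambda>w. if w = 0 then deriv F 0 else F w / w)"
  have Fa: "F analytic_on {0}" "F 0 = 0" and d: "deriv F 0 = 1"
    using F deriv_inverse_near_0[OF f F] by (auto simp: inverse_near_0_def)
  obtain e where e: "e > 0" "F holomorphic_on ball 0 e"
    using Fa(1) by (auto simp: analytic_on_def)
  have "(\<lambda>z. if z = 0 then deriv F 0 else (F z - F 0) / (z - 0)) holomorphic_on ball 0 e"
    by (rule pole_theorem_open_0[where g = F and a = 0]) (use e Fa(2) in auto)
  then have "g holomorphic_on ball 0 e"
    by (simp add: g_def Fa(2) cong: if_cong)
  then have g: "g analytic_on {0}"
    unfolding analytic_at using e(1) by (intro exI[of _ "ball 0 e"]) simp
  have g0: "g 0 = 1" by (simp add: g_def d)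
  have lq: "log_quotient F = (\<lambda>w. Ln (g w))"
    by (auto simp: log_quotient_def g_def d)
  have "(\<lambda>w. Ln (g w)) analytic_on {0}"
    by (intro analytic_intros g) (simp add: g0)
  then have "log_quotient F has_fps_expansion fps_expansion (log_quotient F) 0"
    unfolding lq using analytic_at_imp_has_fps_expansion_0 by blast
  then have pos: "fps_conv_radius (fps_expansion (log_quotient F) 0) > 0"
    and ev: "\<forall>\<^sub>F w in nhds 0. eval_fps (fps_expansion (log_quotient F) 0) w = log_quotient F w"
    by (auto simp: has_fps_expansion_def)
  have "\<forall>\<^sub>F w::complex in nhds 0. w \<in> eball 0 (fps_conv_radius (fps_expansion (log_quotient F) 0))"
    by (intro eventually_nhds_in_open) (use pos in \<open>auto simp: zero_ereal_def\<close>)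
  with ev have "\<forall>\<^sub>F w in nhds 0.
      (\<lambda>n. fps_nth (fps_expansion (log_quotient F) 0) n * w ^ n) sums log_quotient F w"
  proof eventually_elim
    case (elim w)
    then show ?case
      using sums_eval_fps[of w "fps_expansion (log_quotient F) 0"] by simp
  qed
  then have "\<forall>\<^sub>F w in at 0.
      (\<lambda>n. fps_nth (fps_expansion (log_quotient F) 0) n * w ^ n) sums log_quotient F w"
    by (rule filter_leD[OF at_within_le_nhds])
  moreover have "\<forall>\<^sub>F w::complex in at 0. w \<noteq> 0"
    by (simp add: eventually_at_filter)
  ultimately show ?thesis
  proof eventually_elim
    case (elim w)
    have "fps_nth (fps_expansion (log_quotient F) 0) 0 = 0"
      by (simp add: fps_expansion_def log_quotient_def)
    with elim show ?case
      by (subst sums_Suc_iff) (simp add: log_inverse_coeff_def log_quotient_def)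
  qed
qed

end

theory Submission
  imports Defs
begin

text \<open>
  Write \<open>f z = z + a\<^sub>2 z\<^sup>2 + a\<^sub>3 z\<^sup>3 + \<dots>\<close>. Comparing coefficients in \<open>f (F w) = w\<close> with
  \<open>F w = w * exp (2 * (\<Gamma>\<^sub>1 w + \<Gamma>\<^sub>2 w\<^sup>2 + \<dots>))\<close> expresses \<open>\<Gamma>\<^sub>1, \<Gamma>\<^sub>2, \<Gamma>\<^sub>3\<close> as polynomials in
  \<open>a\<^sub>2, a\<^sub>3, a\<^sub>4\<close> (\<open>log_inverse_coeff_formulas\<close>).

  Convexity enters through a bounded function. Put \<open>q = z f'' / f'\<close>. The condition \<open>Re (1 + q) > 0\<close>
  says exactly that \<open>q / (2 + q)\<close> maps the disc into itself, and this function vanishes at the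
  origin, so it is \<open>z g\<close> with \<open>\<bar>g\<bar> \<le> 1\<close> on the disc. If \<open>g = c\<^sub>0 + c\<^sub>1 z + c\<^sub>2 z\<^sup>2 + \<dots>\<close>, then
  \<open>f'' (1 - z g) = 2 g f'\<close> yields (\<open>convex_class_coeffs\<close>)
  \<open>- 2 \<Gamma>\<^sub>1 = c\<^sub>0\<close>, \<open>- 12 \<Gamma>\<^sub>2 = 2 c\<^sub>1 - 3 c\<^sub>0\<^sup>2\<close> and
  \<open>- 12 \<Gamma>\<^sub>3 = 2 c\<^sub>0\<^sup>3 - 3 c\<^sub>0 c\<^sub>1 + c\<^sub>2\<close>.
  It remains to bound these three expressions by 1, 3 and 2 over all such \<open>g\<close>. Two steps of the
  Schur algorithm parametrize the possible triples \<open>(c\<^sub>0, c\<^sub>1, c\<^sub>2)\<close> by three points of the closed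
  unit disc (\<open>schur_parameters\<close>). The first two bounds are then immediate. For the third the
  triangle inequality is applied only to the term with the last parameter; the absolute values
  of the other terms cannot be separated without losing the sharp constant. What is left is the
  inequality \<open>schur_cubic_bound\<close> in one real and one complex variable, which reduces to the
  positivity of a quadratic form.

  For \<open>z / (1 - z)\<close> all \<open>a\<^sub>n\<close> are 1, and the formulas give \<open>\<Gamma>\<^sub>n = (-1)\<^sup>n / (2 n)\<close>.
\<close>

section \<open>Comparing power series\<close>

lemma fps_mult_nth_2:
  fixes A B :: "'a::semiring_0 fps"
  shows "fps_nth (A * B) 2 =
    fps_nth A 0 * fps_nth B 2 + fps_nth A 1 * fps_nth B 1 + fps_nth A 2 * fps_nth B 0"
  by (simp add: fps_mult_nth numeral_2_eq_2)

lemma has_fps_expansion_transfer: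
  assumes "u has_fps_expansion A" "\<forall>\<^sub>F z in nhds 0. u z = v z"
  shows "v has_fps_expansion A"
  using assms has_fps_expansion_cong[of u v A A] by simp

lemma fps_expansions_eq_on_disc:
  fixes u v :: "complex \<Rightarrow> complex"
  assumes u: "u has_fps_expansion A" and v: "v has_fps_expansion B"
    and eq: "\<And>z. norm z < 1 \<Longrightarrow> u z = v z"
  shows "A = B"
proof -
  have "\<forall>\<^sub>F z in nhds 0. u z = v z"
    using eventually_nhds_in_open[of "ball 0 1" "0::complex"] eq
    by (auto elim!: eventually_mono)
  with u have "v has_fps_expansion A" by (rule has_fps_expansion_transfer)
  then show ?thesis using v by (rule fps_expansion_unique_complex)
qed

section \<open>The Schur algorithm\<close>

text \<open>
  Composing \<open>g\<close> with the disc automorphism that takes \<open>g 0\<close> to 0 gives, by the Schwarz lemma, a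
  function \<open>z h\<close> with \<open>h\<close> bounded by 1. Stating the result without the quotient includes the
  constants of modulus 1, for which the automorphism degenerates; \<open>h = 0\<close> serves there.
\<close>
lemma schur_step:
  assumes g: "g holomorphic_on ball 0 1" and bound: "\<And>z. norm z < 1 \<Longrightarrow> norm (g z) \<le> 1"
  obtains h where "h holomorphic_on ball 0 1" "\<And>z. norm z < 1 \<Longrightarrow> norm (h z) \<le> 1"
    "\<And>z. norm z < 1 \<Longrightarrow> g z - g 0 = z * h z * (1 - cnj (g 0) * g z)"
proof (cases "\<forall>z. norm z < 1 \<longrightarrow> norm (g z) < 1")
  case True
  define m where "m = (\<lambda>z. Moebius_function 0 (g 0) (g z))"
  have a: "norm (g 0) < 1" using True by simp
  have m: "m holomorphic_on ball 0 1"
    unfolding m_def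
    using holomorphic_on_compose_gen[OF g Moebius_function_holomorphic[OF a, of 0]] True
    by (auto simp: o_def image_subset_iff)
  have m0: "m 0 = 0" by (simp add: m_def Moebius_function_eq_zero)
  have m1: "norm (m z) < 1" if "norm z < 1" for z
    unfolding m_def using True that by (intro Moebius_function_norm_lt_1[OF a]) auto
  obtain h where h: "h holomorphic_on ball 0 1" "\<And>z. norm z < 1 \<Longrightarrow> m z = z * h z" "deriv m 0 = h 0"
    using Schwarz3[OF m m0] by blast
  have "norm (h z) \<le> 1" if z: "norm z < 1" for z
  proof (cases "z = 0")
    case True
    then show ?thesis using Schwarz_Lemma(2)[OF m m0 m1, of 0] h(3) by simp
  next
    case False
    have "norm z * norm (h z) \<le> norm z * 1"
      using Schwarz_Lemma(1)[OF m m0 m1 z] h(2)[OF z] by (simp add: norm_mult)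
    then show ?thesis using False by simp
  qed
  moreover have "g z - g 0 = z * h z * (1 - cnj (g 0) * g z)" if z: "norm z < 1" for z
  proof -
    have "norm (cnj (g 0) * g z) < 1"
      using norm_mult_less[of "cnj (g 0)" 1 "g z" 1] a True z by simp
    then have "1 - cnj (g 0) * g z \<noteq> 0" by auto
    then show ?thesis
      using h(2)[OF z] by (simp add: m_def Moebius_function_simple field_simps)
  qed
  ultimately show ?thesis using h(1) that by blast
next
  case False
  then obtain w where w: "norm w < 1" "norm (g w) = 1" using bound by fastforce
  have "g constant_on ball 0 1"
    by (rule maximum_modulus_principle[OF g open_ball _ open_ball order_refl, of w])
      (use w bound in auto)
  then obtain c where "g z = c" if "norm z < 1" for z
    by (auto simp: constant_on_def)
  then show ?thesis by (intro that[of "\<lambda>_. 0"]) auto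
qed

text \<open>
  The parameters are \<open>\<zeta> = h 0\<close> and \<open>\<xi> = k 0\<close>, where \<open>h\<close> and \<open>k\<close> are the results of one and two
  Schur steps. They are known to lie in the closed disc, and the coefficients of \<open>g\<close> are found by
  comparing the lowest coefficients in the defining relations.
\<close>
lemma schur_parameters:
  assumes g: "g holomorphic_on ball 0 1" and bound: "\<And>z. norm z < 1 \<Longrightarrow> norm (g z) \<le> 1"
    and G: "g has_fps_expansion G"
  obtains \<zeta> \<xi> where "norm (fps_nth G 0) \<le> 1" "norm \<zeta> \<le> 1" "norm \<xi> \<le> 1"
    "fps_nth G 1 = of_real (1 - (norm (fps_nth G 0))\<^sup>2) * \<zeta>"
    "fps_nth G 2 = of_real (1 - (norm (fps_nth G 0))\<^sup>2) *
       (of_real (1 - (norm \<zeta>)\<^sup>2) * \<xi> - cnj (fps_nth G 0) * \<zeta>\<^sup>2)"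
proof -
  have rel: "P - fps_const (p 0) = fps_X * H * (1 - fps_const (cnj (p 0)) * P)"
    if "p has_fps_expansion P" "h has_fps_expansion H"
      "\<And>z. norm z < 1 \<Longrightarrow> p z - p 0 = z * h z * (1 - cnj (p 0) * p z)" for p h P H
  proof (rule fps_expansions_eq_on_disc[OF _ _ that(3)])
    show "(\<lambda>z. p z - p 0) has_fps_expansion P - fps_const (p 0)"
      by (intro fps_expansion_intros that)
    show "(\<lambda>z. z * h z * (1 - cnj (p 0) * p z)) has_fps_expansion
        fps_X * H * (1 - fps_const (cnj (p 0)) * P)"
      by (intro fps_expansion_intros that)
  qed
  have at_0: "fps_nth P 0 = p 0" if "p has_fps_expansion P" for p :: "complex \<Rightarrow> complex" and P
    using that has_fps_expansion_imp_0_eq_fps_nth_0 by metis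
  obtain h where h: "h holomorphic_on ball 0 1" "\<And>z. norm z < 1 \<Longrightarrow> norm (h z) \<le> 1"
    "\<And>z. norm z < 1 \<Longrightarrow> g z - g 0 = z * h z * (1 - cnj (g 0) * g z)"
    by (rule schur_step[OF g bound]) auto
  obtain k where k: "k holomorphic_on ball 0 1" "\<And>z. norm z < 1 \<Longrightarrow> norm (k z) \<le> 1"
    "\<And>z. norm z < 1 \<Longrightarrow> h z - h 0 = z * k z * (1 - cnj (h 0) * h z)"
    by (rule schur_step[OF h(1,2)]) auto
  define H where "H = fps_expansion h 0"
  define K where "K = fps_expansion k 0"
  have H: "h has_fps_expansion H" and K: "k has_fps_expansion K"
    unfolding H_def K_def
    by (rule has_fps_expansion_fps_expansion[of "ball 0 1"]; use h k in simp)+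
  note G0 = at_0[OF G] and H0 = at_0[OF H] and K0 = at_0[OF K]
  have nsq: "of_real (1 - (norm z)\<^sup>2) = 1 - z * cnj z" for z
    by (simp only: of_real_diff complex_norm_square) simp
  have H1: "fps_nth H 1 = of_real (1 - (norm (h 0))\<^sup>2) * k 0"
    using arg_cong[OF rel[OF H K k(3)], of "\<lambda>P. fps_nth P 1"] H0 K0
    unfolding nsq by (simp add: fps_mult_nth algebra_simps)
  have G1: "fps_nth G 1 = of_real (1 - (norm (g 0))\<^sup>2) * h 0"
    using arg_cong[OF rel[OF G H h(3)], of "\<lambda>P. fps_nth P 1"] H0 G0
    unfolding nsq by (simp add: fps_mult_nth algebra_simps)
  have "fps_nth G 2 = of_real (1 - (norm (g 0))\<^sup>2) * fps_nth H 1 - h 0 * cnj (g 0) * fps_nth G 1"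
    using arg_cong[OF rel[OF G H h(3)], of "\<lambda>P. fps_nth P 2"] H0 G0
    unfolding nsq by (simp add: fps_mult_nth algebra_simps numeral_2_eq_2)
  also have "\<dots> = of_real (1 - (norm (g 0))\<^sup>2) *
       (of_real (1 - (norm (h 0))\<^sup>2) * k 0 - cnj (g 0) * (h 0)\<^sup>2)"
    unfolding H1 G1 by (simp add: algebra_simps power2_eq_square)
  finally show ?thesis
    using that[of "h 0" "k 0"] G1 G0 bound h(2) k(2) by simp
qed

section \<open>Sharp coefficient inequalities for bounded functions\<close>

text \<open>
  Both sides are nonnegative and are compared by their squares. With \<open>t = 1 - x\<^sup>2\<close>, \<open>u = Re \<zeta>\<close> and
  \<open>s = \<bar>\<zeta>\<bar>\<^sup>2\<close>, the difference of the squares is \<open>t\<close> times a quadratic form in \<open>t\<close> and \<open>1 - t\<close>, with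
  coefficients \<open>A, N, -K\<close>. Here \<open>A\<close> and \<open>N\<close> are positive, and \<open>K\<close> is positive only if \<open>u\<close> is; but then
  \<open>A \<ge> 1\<close>, \<open>N \<ge> 8\<close> and \<open>K \<le> 4\<close>, which makes the form positive definite.
\<close>
lemma schur_cubic_bound:
  fixes \<zeta> :: complex and x :: real
  assumes x: "0 \<le> x" "x \<le> 1" and \<zeta>: "norm \<zeta> \<le> 1"
  shows "x * norm (2 - of_real (1 - x\<^sup>2) * ((1 + \<zeta>) * (2 + \<zeta>)))
    \<le> 2 - (1 - x\<^sup>2) * (1 - (norm \<zeta>)\<^sup>2)"
proof (rule power2_le_imp_le)
  define t where "t = 1 - x\<^sup>2"
  define u where "u = Re \<zeta>"
  define v where "v = Im \<zeta>"
  define s where "s = (norm \<zeta>)\<^sup>2"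
  have t: "0 \<le> t" "t \<le> 1" and x2: "x\<^sup>2 = 1 - t" using x by (auto simp: t_def power_le_one)
  have s: "0 \<le> s" "s \<le> 1" "s = u\<^sup>2 + v\<^sup>2"
    using \<zeta> by (simp_all add: s_def power_le_one u_def v_def) (simp add: cmod_power2)
  have u: "\<bar>u\<bar> \<le> 1" using \<zeta> abs_Re_le_cmod[of \<zeta>] by (simp add: u_def)
  define A where "A = (1 + s)\<^sup>2"
  define N where "N = 8 + 12 * u + 8 * u\<^sup>2"
  define K where "K = 3 * s + 6 * u * s - 5"
  have gap: "(2 - t * (1 - s))\<^sup>2 - (1 - t) * (norm (2 - of_real t * ((1 + \<zeta>) * (2 + \<zeta>))))\<^sup>2
      = t * (t\<^sup>2 * A + (1 - t)\<^sup>2 * N - t * (1 - t) * K)"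
    unfolding cmod_power2 A_def N_def K_def s(3) u_def v_def
    by (simp add: power2_eq_square) algebra
  have "t * (1 - t) * K \<le> t\<^sup>2 * A + (1 - t)\<^sup>2 * N"
  proof (cases "u \<ge> 0")
    case True
    have "u * s \<le> 1 * 1" using u s by (intro mult_mono) auto
    then have "t * (1 - t) * K \<le> t * (1 - t) * 4"
      using t s by (intro mult_left_mono) (auto simp: K_def)
    also have "\<dots> \<le> t\<^sup>2 * 1 + (1 - t)\<^sup>2 * 8"
      \<comment> \<open>The difference is a sum of two squares.\<close>
      using sum_power2_ge_zero[of "t - 2 * (1 - t)" "2 * (1 - t)"]
      by (simp add: power2_eq_square algebra_simps)
    also have "\<dots> \<le> t\<^sup>2 * A + (1 - t)\<^sup>2 * N"
      using True s by (intro add_mono mult_left_mono) (auto simp: A_def N_def)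
    finally show ?thesis .
  next
    case False
    then have "u * s \<le> 0" using s by (simp add: mult_nonpos_nonneg)
    then have "t * (1 - t) * K \<le> 0" using t s by (intro mult_nonneg_nonpos) (auto simp: K_def)
    moreover have "N = 8 * (u + 3/4)\<^sup>2 + 7/2"
      by (simp add: N_def power2_eq_square algebra_simps)
    then have "N \<ge> 0" by simp
    ultimately show ?thesis using t by (smt (verit) A_def mult_nonneg_nonneg zero_le_power2)
  qed
  then have "0 \<le> t * (t\<^sup>2 * A + (1 - t)\<^sup>2 * N - t * (1 - t) * K)"
    using t by simp
  then show "(x * norm (2 - of_real (1 - x\<^sup>2) * ((1 + \<zeta>) * (2 + \<zeta>))))\<^sup>2
    \<le> (2 - (1 - x\<^sup>2) * (1 - (norm \<zeta>)\<^sup>2))\<^sup>2"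
    unfolding power_mult_distrib gap[symmetric] x2 s_def[symmetric] by simp
  have "t * (1 - s) \<le> 1 * 1" using t s by (intro mult_mono) auto
  then show "0 \<le> 2 - (1 - x\<^sup>2) * (1 - (norm \<zeta>)\<^sup>2)"
    by (simp add: t_def s_def)
qed

text \<open>
  Replacing \<open>g z\<close> by \<open>e\<^sup>-\<^sup>1 g (e\<^sup>-\<^sup>1 z)\<close> with \<open>\<bar>e\<bar> = 1\<close> multiplies the functional by \<open>e\<^sup>-\<^sup>3\<close>, so \<open>c\<^sub>0\<close> may be
  taken to be real and nonnegative. In the Schur parameters this rotation turns \<open>\<zeta>\<close> into
  \<open>\<eta> = e\<^sup>-\<^sup>2 \<zeta>\<close>. For real \<open>c\<^sub>0 = x\<close> the part of the functional without \<open>\<xi>\<close> factors into the expression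
  of \<open>schur_cubic_bound\<close>.
\<close>
lemma schur_cubic_functional_bound:
  fixes G :: "complex fps"
  assumes g: "g holomorphic_on ball 0 1" and bound: "\<And>z. norm z < 1 \<Longrightarrow> norm (g z) \<le> 1"
    and G: "g has_fps_expansion G"
  shows "norm (2 * fps_nth G 0 ^ 3 - 3 * fps_nth G 0 * fps_nth G 1 + fps_nth G 2) \<le> 2"
proof -
  define c where "c = fps_nth G 0"
  define x where "x = norm c"
  obtain \<zeta> \<xi> where c: "norm c \<le> 1" and \<zeta>: "norm \<zeta> \<le> 1" and \<xi>: "norm \<xi> \<le> 1"
    and G1: "fps_nth G 1 = of_real (1 - x\<^sup>2) * \<zeta>"
    and G2: "fps_nth G 2 = of_real (1 - x\<^sup>2) * (of_real (1 - (norm \<zeta>)\<^sup>2) * \<xi> - cnj c * \<zeta>\<^sup>2)"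
    unfolding x_def c_def by (rule schur_parameters[OF g bound G]) auto
  define e where "e = (if c = 0 then 1 else sgn c)"
  have e: "norm e = 1" "c = of_real x * e"
    by (auto simp: e_def norm_sgn x_def sgn_eq norm_divide)
  have ee: "e * cnj e = 1" using e(1) by (simp add: complex_norm_square[symmetric])
  define \<eta> where "\<eta> = \<zeta> * (cnj e)\<^sup>2"
  have \<eta>: "norm \<eta> = norm \<zeta>" by (simp add: \<eta>_def norm_mult norm_power e)
  have \<zeta>\<eta>: "\<zeta> = e\<^sup>2 * \<eta>"
    using ee unfolding \<eta>_def by algebra
  have x: "0 \<le> x" "x \<le> 1" using c by (auto simp: x_def)
  have "2 * c ^ 3 - 3 * c * fps_nth G 1 + fps_nth G 2 =
      e ^ 3 * (of_real x * (2 - of_real (1 - x\<^sup>2) * ((1 + \<eta>) * (2 + \<eta>))))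
      + of_real (1 - x\<^sup>2) * of_real (1 - (norm \<zeta>)\<^sup>2) * \<xi>"
    unfolding G1 G2 e(2) \<zeta>\<eta> using ee by (simp add: of_real_diff) algebra
  also have "norm \<dots> \<le> norm (e ^ 3 * (of_real x * (2 - of_real (1 - x\<^sup>2) * ((1 + \<eta>) * (2 + \<eta>)))))
      + norm (of_real (1 - x\<^sup>2) * of_real (1 - (norm \<zeta>)\<^sup>2) * \<xi>)"
    by (rule norm_triangle_ineq)
  also have "\<dots> = x * norm (2 - of_real (1 - x\<^sup>2) * ((1 + \<eta>) * (2 + \<eta>)))
      + (1 - x\<^sup>2) * (1 - (norm \<zeta>)\<^sup>2) * norm \<xi>"
    using x \<zeta> by (simp add: norm_mult norm_power e(1) power_le_one del: of_real_diff of_real_power)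
  also have "(1 - x\<^sup>2) * (1 - (norm \<zeta>)\<^sup>2) * norm \<xi> \<le> (1 - x\<^sup>2) * (1 - (norm \<zeta>)\<^sup>2) * 1"
    using x \<zeta> \<xi> by (intro mult_left_mono) (auto simp: power_le_one)
  also have "x * norm (2 - of_real (1 - x\<^sup>2) * ((1 + \<eta>) * (2 + \<eta>)))
     \<le> 2 - (1 - x\<^sup>2) * (1 - (norm \<zeta>)\<^sup>2)"
    using schur_cubic_bound[OF x, of \<eta>] \<eta> \<zeta> by simp
  finally show ?thesis by (simp add: c_def)
qed

lemma schur_quadratic_functional_bound:
  fixes G :: "complex fps"
  assumes g: "g holomorphic_on ball 0 1" and bound: "\<And>z. norm z < 1 \<Longrightarrow> norm (g z) \<le> 1"
    and G: "g has_fps_expansion G"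
  shows "norm (2 * fps_nth G 1 - 3 * fps_nth G 0 ^ 2) \<le> 3"
proof -
  define x where "x = norm (fps_nth G 0)"
  obtain \<zeta> \<xi> :: complex where x: "x \<le> 1" and \<zeta>: "norm \<zeta> \<le> 1"
    and G1: "fps_nth G 1 = of_real (1 - x\<^sup>2) * \<zeta>"
    unfolding x_def by (rule schur_parameters[OF g bound G]) auto
  have x2: "x\<^sup>2 \<le> 1" using x by (simp add: x_def power_le_one)
  have "norm (2 * fps_nth G 1 - 3 * fps_nth G 0 ^ 2)
      \<le> norm (2 * fps_nth G 1) + norm (3 * fps_nth G 0 ^ 2)"
    by (rule norm_triangle_ineq4)
  also have "\<dots> = 2 * ((1 - x\<^sup>2) * norm \<zeta>) + 3 * x\<^sup>2"
    using x2 unfolding G1 x_def by (simp add: norm_mult norm_power del: of_real_diff of_real_power)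
  also have "(1 - x\<^sup>2) * norm \<zeta> \<le> (1 - x\<^sup>2) * 1"
    using x2 \<zeta> by (intro mult_left_mono) auto
  finally show ?thesis using x2 by simp
qed

section \<open>Coefficients of convex functions\<close>

text \<open>
  Since \<open>\<bar>2 + q\<bar>\<^sup>2 - \<bar>q\<bar>\<^sup>2 = 4 * Re (1 + q)\<close>, convexity is the bound \<open>\<bar>q / (2 + q)\<bar> < 1\<close> for
  \<open>q = z f'' / f'\<close>. A Schur step at the zero \<open>z = 0\<close> of this quotient only divides it by \<open>z\<close>.
\<close>
lemma convex_class_schur_function:
  assumes f: "f \<in> convex_class"
  obtains g where "g holomorphic_on ball 0 1" "\<And>z. norm z < 1 \<Longrightarrow> norm (g z) \<le> 1"
    "\<And>z. norm z < 1 \<Longrightarrow> z * deriv (deriv f) z * (1 - z * g z) = 2 * z * g z * deriv f z"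
proof -
  have holf: "f holomorphic_on ball 0 1"
    and d: "\<And>z. norm z < 1 \<Longrightarrow> deriv f z \<noteq> 0"
    and re: "\<And>z. norm z < 1 \<Longrightarrow> Re (1 + z * deriv (deriv f) z / deriv f z) > 0"
    using f by (auto simp: convex_class_def normalized_analytic_def)
  define q where "q = (\<lambda>z. z * deriv (deriv f) z / deriv f z)"
  define \<omega> where "\<omega> = (\<lambda>z. q z / (2 + q z))"
  have q: "q holomorphic_on ball 0 1"
    unfolding q_def by (intro holomorphic_intros holf) (use d in auto)
  have q2: "2 + q z \<noteq> 0" and lt: "norm (\<omega> z) < 1" if "norm z < 1" for z
  proof -
    have r: "Re (q z) > -1" using re[OF that] by (simp add: q_def)
    show nz: "2 + q z \<noteq> 0" using r by (auto simp: complex_eq_iff)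
    have "(norm (q z))\<^sup>2 < (norm (2 + q z))\<^sup>2"
      using r unfolding cmod_power2 by (simp add: power2_eq_square algebra_simps)
    then have "norm (q z) < norm (2 + q z)"
      by (rule power2_less_imp_less) simp
    then show "norm (\<omega> z) < 1" using nz by (simp add: \<omega>_def norm_divide)
  qed
  have "\<omega> holomorphic_on ball 0 1"
    unfolding \<omega>_def by (intro holomorphic_intros q) (use q2 in auto)
  then obtain g where g: "g holomorphic_on ball 0 1" "\<And>z. norm z < 1 \<Longrightarrow> norm (g z) \<le> 1"
    "\<And>z. norm z < 1 \<Longrightarrow> \<omega> z - \<omega> 0 = z * g z * (1 - cnj (\<omega> 0) * \<omega> z)"
    by (rule schur_step) (use lt in \<open>auto intro: less_imp_le\<close>)
  have "z * deriv (deriv f) z * (1 - z * g z) = 2 * z * g z * deriv f z" if z: "norm z < 1" for z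
  proof -
    have "\<omega> z = z * g z" using g(3)[OF z] by (simp add: \<omega>_def q_def)
    then have "q z * (1 - z * g z) = 2 * z * g z"
      using q2[OF z] by (simp add: \<omega>_def field_simps)
    moreover have "z * deriv (deriv f) z = q z * deriv f z" using d[OF z] by (simp add: q_def)
    ultimately show ?thesis by (simp add: mult.commute mult.left_commute)
  qed
  with g that show ?thesis by blast
qed

text \<open>
  The differential equation of the previous lemma carries a factor \<open>z\<close> on both sides, which cancels
  in the ring of formal power series. The coefficients 0, 1 and 2 of \<open>f'' (1 - z g) = 2 g f'\<close> then
  determine \<open>a\<^sub>2, a\<^sub>3, a\<^sub>4\<close> successively.
\<close>
lemma convex_class_coeffs:
  assumes f: "f \<in> convex_class" and P: "f has_fps_expansion P"
  obtains g G where "g holomorphic_on ball 0 1" "\<And>z. norm z < 1 \<Longrightarrow> norm (g z) \<le> 1"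
    "g has_fps_expansion G"
    "fps_nth P 2 = fps_nth G 0"
    "3 * fps_nth P 3 = fps_nth G 1 + 3 * fps_nth G 0 ^ 2"
    "6 * fps_nth P 4 = fps_nth G 2 + 5 * fps_nth G 0 * fps_nth G 1 + 6 * fps_nth G 0 ^ 3"
proof -
  obtain g where g: "g holomorphic_on ball 0 1" "\<And>z. norm z < 1 \<Longrightarrow> norm (g z) \<le> 1"
    "\<And>z. norm z < 1 \<Longrightarrow> z * deriv (deriv f) z * (1 - z * g z) = 2 * z * g z * deriv f z"
    by (rule convex_class_schur_function[OF f]) auto
  define G where "G = fps_expansion g 0"
  have G: "g has_fps_expansion G"
    unfolding G_def by (rule has_fps_expansion_fps_expansion[of "ball 0 1"]) (use g in simp_all)
  have P1: "fps_nth P 1 = 1"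
    using f fps_nth_fps_expansion[OF P, of 1] by (simp add: convex_class_def normalized_analytic_def)
  have "fps_X * fps_deriv (fps_deriv P) * (1 - fps_X * G) = 2 * fps_X * G * fps_deriv P"
  proof (rule fps_expansions_eq_on_disc[OF _ _ g(3)])
    show "(\<lambda>z. z * deriv (deriv f) z * (1 - z * g z)) has_fps_expansion
        fps_X * fps_deriv (fps_deriv P) * (1 - fps_X * G)"
      by (intro fps_expansion_intros G P)
    show "(\<lambda>z. 2 * z * g z * deriv f z) has_fps_expansion 2 * fps_X * G * fps_deriv P"
      by (intro fps_expansion_intros G P)
  qed
  then have "fps_X * (fps_deriv (fps_deriv P) * (1 - fps_X * G)) = fps_X * (2 * G * fps_deriv P)"
    by (simp add: mult_ac)
  then have eq: "fps_nth (fps_deriv (fps_deriv P) * (1 - fps_X * G)) n =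
      fps_nth (2 * G * fps_deriv P) n" for n
    by simp
  have two: "fps_nth (2 * Q) n = 2 * fps_nth Q n" for Q :: "complex fps" and n
    by (simp add: fps_numeral_fps_const)
  have s: "Suc (Suc 0) = 2" "Suc (Suc (Suc 0)) = 3" "Suc (Suc (Suc (Suc 0))) = 4" by simp_all
  have e2: "fps_nth P 2 = fps_nth G 0"
    using eq[of 0] P1 by (simp add: s two mult.assoc)
  moreover have "2 * (3 * fps_nth P 3) = 2 * (fps_nth G 1 + 3 * fps_nth G 0 ^ 2)"
    using eq[of 1] P1 unfolding mult.assoc two
    by (simp add: fps_mult_nth s e2 power2_eq_square algebra_simps)
  then have e3: "3 * fps_nth P 3 = fps_nth G 1 + 3 * fps_nth G 0 ^ 2"
    by (simp only: mult_cancel_left) simp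
  moreover have "6 * fps_nth P 4 = fps_nth G 2 + 5 * fps_nth G 0 * fps_nth G 1 + 6 * fps_nth G 0 ^ 3"
  proof -
    have "12 * fps_nth P 4 - 6 * fps_nth P 3 * fps_nth G 0 - 2 * fps_nth P 2 * fps_nth G 1
       = 2 * (3 * fps_nth P 3 * fps_nth G 0 + 2 * fps_nth P 2 * fps_nth G 1 + fps_nth G 2)"
      using eq[of 2] P1 unfolding mult.assoc two unfolding fps_mult_nth_2
      by (simp add: s algebra_simps)
    then show ?thesis using e2 e3 by algebra
  qed
  ultimately show ?thesis using that[OF g(1,2) G] by blast
qed

section \<open>Logarithmic inverse coefficients in terms of the coefficients of the function\<close>

text \<open>
  Passing to the exponential turns the definition of the logarithmic coefficients into an identity
  for the series of \<open>F\<close> itself, which can be substituted into \<open>f (F w) = w\<close>.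
\<close>
lemma log_quotient_expansion:
  assumes f: "f \<in> normalized_analytic" and F: "inverse_near_0 f F"
  obtains L where "log_quotient F has_fps_expansion L" "fps_nth L 0 = 0"
    "F has_fps_expansion fps_X * fps_compose (fps_exp 1) L"
proof -
  have Fa: "F analytic_on {0}" "F 0 = 0" and d: "deriv F 0 = 1"
    using F deriv_inverse_near_0[OF f F] by (auto simp: inverse_near_0_def)
  define q where "q = (\<lambda>w. if w = 0 then 1 else F w / w)"
  define P where "P = fps_expansion F 0"
  have P: "F has_fps_expansion P"
    unfolding P_def by (rule analytic_at_imp_has_fps_expansion_0[OF Fa(1)])
  have P0: "fps_nth P 0 = 0" and P1: "fps_nth P 1 = 1"
    using fps_nth_fps_expansion[OF P, of 0] fps_nth_fps_expansion[OF P, of 1] Fa d by simp_all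
  have "subdegree P = 1" using P0 P1 by (intro subdegreeI) auto
  then have "q has_fps_expansion fps_shift 1 P"
    unfolding q_def using P P1 using has_fps_expansion_shift[of F P 1 1] by (simp cong: if_cong)
  then have qa: "q analytic_on {0}" by (rule has_fps_expansion_imp_analytic_0)
  have q0: "q 0 = 1" by (simp add: q_def)
  have lq: "log_quotient F = (\<lambda>w. Ln (q w))"
    by (auto simp: log_quotient_def q_def)
  define L where "L = fps_expansion (log_quotient F) 0"
  have "(\<lambda>w. Ln (q w)) analytic_on {0}"
    by (intro analytic_intros qa) (simp add: q0)
  then have L: "log_quotient F has_fps_expansion L"
    unfolding lq L_def by (rule analytic_at_imp_has_fps_expansion_0)
  have L0: "fps_nth L 0 = 0"
    using fps_nth_fps_expansion[OF L, of 0] by (simp add: log_quotient_def)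
  have "(exp \<circ> log_quotient F) has_fps_expansion fps_compose (fps_exp 1) L"
    by (intro fps_expansion_intros L L0)
  then have E: "(\<lambda>w. w * exp (log_quotient F w)) has_fps_expansion fps_X * fps_compose (fps_exp 1) L"
    unfolding o_def by (intro fps_expansion_intros)
  \<comment> \<open>\<open>exp\<close> undoes \<open>Ln\<close> only at nonzero arguments; \<open>F w = 0\<close> would give
      \<open>w = f (F w) = f 0 = 0\<close>.\<close>
  have f0: "f 0 = 0" and "\<forall>\<^sub>F w in nhds 0. f (F w) = w"
    using f F by (auto simp: inverse_near_0_def normalized_analytic_def)
  from this(2) have "\<forall>\<^sub>F w in nhds 0. w * exp (log_quotient F w) = F w"
  proof eventually_elim
    case (elim w)
    then have "F w \<noteq> 0" if "w \<noteq> 0" using that f0 by auto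
    then show ?case using Fa by (simp add: log_quotient_def)
  qed
  then have "F has_fps_expansion fps_X * fps_compose (fps_exp 1) L"
    by (rule has_fps_expansion_transfer[OF E])
  then show ?thesis using that L L0 by blast
qed

text \<open>
  With \<open>L\<close> the series of \<open>Ln (F w / w)\<close> and \<open>Q = exp L\<close>, the inverse has the series \<open>w Q\<close>. The
  equation \<open>Q' = Q L'\<close> gives the coefficients of \<open>Q\<close> from those of \<open>L\<close>, the equation \<open>f (w Q) = w\<close>
  relates them to the coefficients of \<open>f\<close>, and eliminating \<open>Q\<close> leaves the three formulas.
\<close>
lemma log_inverse_coeff_formulas:
  assumes f: "f \<in> normalized_analytic" and F: "inverse_near_0 f F" and P: "f has_fps_expansion P"
  shows "log_inverse_coeff F 1 = - fps_nth P 2 / 2"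
    and "log_inverse_coeff F 2 = - (fps_nth P 3 - 3 / 2 * fps_nth P 2 ^ 2) / 2"
    and "log_inverse_coeff F 3 =
      - (fps_nth P 4 - 4 * fps_nth P 2 * fps_nth P 3 + 10 / 3 * fps_nth P 2 ^ 3) / 2"
proof -
  obtain L where L: "log_quotient F has_fps_expansion L" "fps_nth L 0 = 0"
    "F has_fps_expansion fps_X * fps_compose (fps_exp 1) L"
    by (rule log_quotient_expansion[OF f F])
  define Q where "Q = fps_compose (fps_exp 1) L"
  have \<Gamma>: "log_inverse_coeff F n = fps_nth L n / 2" for n
    using fps_expansion_eqI[OF L(1)] by (simp add: log_inverse_coeff_def)
  have "(f \<circ> F) has_fps_expansion fps_compose P (fps_X * Q)"
    unfolding Q_def by (intro fps_expansion_intros P L(3)) simp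
  moreover have "\<forall>\<^sub>F w in nhds 0. (f \<circ> F) w = w"
    using F by (simp add: inverse_near_0_def)
  ultimately have "(\<lambda>w. w) has_fps_expansion fps_compose P (fps_X * Q)"
    by (rule has_fps_expansion_transfer)
  then have inv: "fps_compose P (fps_X * Q) = fps_X"
    using has_fps_expansion_fps_X fps_expansion_unique_complex by blast
  have P1: "fps_nth P 1 = 1" and P0: "fps_nth P 0 = 0"
    using f fps_nth_fps_expansion[OF P, of 1] fps_nth_fps_expansion[OF P, of 0]
    by (simp_all add: normalized_analytic_def)
  have "fps_deriv Q = Q * fps_deriv L"
    unfolding Q_def using L(2) by (simp add: fps_compose_deriv)
  then have Q': "fps_nth (fps_deriv Q) n = fps_nth (Q * fps_deriv L) n" for n by simp
  have Q0: "fps_nth Q 0 = 1" by (simp add: Q_def)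
  have s: "Suc (Suc 0) = 2" "Suc (Suc (Suc 0)) = 3" "Suc (Suc (Suc (Suc 0))) = 4" by simp_all
  have Q1: "fps_nth Q 1 = fps_nth L 1"
    using Q'[of 0] Q0 by simp
  have Q2: "2 * fps_nth Q 2 = 2 * fps_nth L 2 + fps_nth L 1 ^ 2"
    using Q'[of 1] Q0 Q1 by (simp add: fps_mult_nth s algebra_simps power2_eq_square)
  have "3 * fps_nth Q 3 = 3 * fps_nth L 3 + 2 * fps_nth Q 1 * fps_nth L 2 + fps_nth Q 2 * fps_nth L 1"
    using Q'[of 2] Q0 unfolding fps_mult_nth_2 by (simp add: s algebra_simps)
  then have Q3: "6 * fps_nth Q 3 = 6 * fps_nth L 3 + 6 * fps_nth L 1 * fps_nth L 2 + fps_nth L 1 ^ 3"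
    using Q1 Q2 by algebra
  have C: "fps_nth (fps_compose P (fps_X * Q)) n =
      (\<Sum>i=0..n. fps_nth P i * fps_nth (Q ^ i) (n - i))" for n
    unfolding fps_compose_nth power_mult_distrib fps_X_power_mult_nth by (intro sum.cong) auto
  have pow: "fps_nth (Q ^ n) 0 = 1" "fps_nth (Q ^ n) 1 = of_nat n * fps_nth Q 1" for n
    using fps_power_zeroth_eq_one[OF Q0] fps_power_first_eq[OF Q0] by auto
  have Q22: "fps_nth (Q ^ 2) 2 = 2 * fps_nth Q 2 + fps_nth Q 1 ^ 2"
    using Q0 unfolding power2_eq_square[of Q] fps_mult_nth_2 by (simp add: power2_eq_square)
  have rng: "{0..2::nat} = {0, 1, 2}" "{0..3::nat} = {0, 1, 2, 3}" "{0..4::nat} = {0, 1, 2, 3, 4}"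
    by auto
  have C1: "fps_nth Q 1 + fps_nth P 2 = 0"
    using arg_cong[OF inv, of "\<lambda>P. fps_nth P 2"] P0 P1 pow unfolding C
    by (simp add: rng algebra_simps)
  have C2: "fps_nth Q 2 + 2 * fps_nth P 2 * fps_nth Q 1 + fps_nth P 3 = 0"
    using arg_cong[OF inv, of "\<lambda>P. fps_nth P 3"] P0 P1 pow unfolding C
    by (simp add: rng algebra_simps)
  have C3: "fps_nth Q 3 + fps_nth P 2 * (2 * fps_nth Q 2 + fps_nth Q 1 ^ 2)
       + 3 * fps_nth P 3 * fps_nth Q 1 + fps_nth P 4 = 0"
    using arg_cong[OF inv, of "\<lambda>P. fps_nth P 4"] P0 P1 pow unfolding C Q22[symmetric]
    by (simp add: rng algebra_simps)
  have L1: "fps_nth L 1 = - fps_nth P 2"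
    using C1 Q1 by algebra
  show "log_inverse_coeff F 1 = - fps_nth P 2 / 2"
    unfolding \<Gamma> L1 by simp
  have L2: "2 * fps_nth L 2 = - (2 * fps_nth P 3 - 3 * fps_nth P 2 ^ 2)"
    using C2 Q1 Q2 L1 by algebra
  then show "log_inverse_coeff F 2 = - (fps_nth P 3 - 3 / 2 * fps_nth P 2 ^ 2) / 2"
    unfolding \<Gamma> by (simp add: field_simps) algebra
  have "3 * fps_nth L 3 = - (3 * fps_nth P 4 - 12 * fps_nth P 2 * fps_nth P 3 + 10 * fps_nth P 2 ^ 3)"
    using C2 C3 Q1 Q2 Q3 L1 L2 by algebra
  then show "log_inverse_coeff F 3 =
      - (fps_nth P 4 - 4 * fps_nth P 2 * fps_nth P 3 + 10 / 3 * fps_nth P 2 ^ 3) / 2"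
    unfolding \<Gamma> by (simp add: field_simps) algebra
qed

section \<open>The extremal function\<close>

text \<open>
  For \<open>l z = z / (1 - z)\<close> one has \<open>1 + z l'' / l' = (1 + z) / (1 - z)\<close>, the Cayley transform of the
  disc onto the right half-plane.
\<close>
lemma half_plane_map_convex: "(\<lambda>z. z / (1 - z)) \<in> convex_class"
proof -
  let ?l = "\<lambda>z::complex. z / (1 - z)"
  have nz: "1 - z \<noteq> 0" if "norm z < 1" for z :: complex using that by auto
  have d1: "deriv ?l z = inverse (1 - z) ^ 2" if "norm z < 1" for z
    by (rule DERIV_imp_deriv)
      (use nz[OF that] in \<open>auto intro!: derivative_eq_intros simp: field_simps power2_eq_square\<close>)
  have d2: "deriv (deriv ?l) z = 2 * inverse (1 - z) ^ 3" if z: "norm z < 1" for z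
  proof -
    have "\<forall>\<^sub>F y in nhds z. deriv ?l y = inverse (1 - y) ^ 2"
      using eventually_nhds_in_open[of "ball 0 1" z] z d1 by (auto elim!: eventually_mono)
    then have "deriv (deriv ?l) z = deriv (\<lambda>y. inverse (1 - y) ^ 2) z"
      by (intro deriv_cong_ev) auto
    also have "\<dots> = 2 * inverse (1 - z) ^ 3"
      by (rule DERIV_imp_deriv)
        (use nz[OF z] in \<open>auto intro!: derivative_eq_intros simp: eval_nat_numeral\<close>)
    finally show ?thesis .
  qed
  have "Re (1 + z * deriv (deriv ?l) z / deriv ?l z) > 0" if z: "norm z < 1" for z
  proof -
    have "1 + z * deriv (deriv ?l) z / deriv ?l z = (1 + z) / (1 - z)"
      using nz[OF z] unfolding d1[OF z] d2[OF z] by (simp add: power2_eq_square power3_eq_cube) (simp add: field_simps)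
    also have "Re \<dots> = (1 - (norm z)\<^sup>2) / (norm (1 - z))\<^sup>2"
      unfolding Re_divide cmod_power2 by (simp add: power2_eq_square algebra_simps)
    also have "\<dots> > 0"
      using z nz[OF z] by (simp add: abs_square_less_1)
    finally show ?thesis .
  qed
  moreover have "?l holomorphic_on ball 0 1"
    by (intro holomorphic_intros) (use nz in auto)
  ultimately show ?thesis
    using d1 nz by (auto simp: convex_class_def normalized_analytic_def)
qed

lemma half_plane_map_expansion:
  "(\<lambda>z::complex. z / (1 - z)) has_fps_expansion Abs_fps (\<lambda>n. if n = 0 then 0 else 1)"
proof -
  have "(\<lambda>z::complex. z * inverse (1 - z)) has_fps_expansion fps_X * inverse (1 - fps_X)"
    by (intro fps_expansion_intros) auto
  moreover have "fps_X * inverse (1 - fps_X) = Abs_fps (\<lambda>n. if n = 0 then 0 else 1 :: complex)"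
    by (simp add: fps_eq_iff flip: fps_inverse_gp')
  ultimately show ?thesis by (simp add: divide_inverse)
qed

lemma log_inverse_coeff_half_plane_map:
  assumes F: "inverse_near_0 (\<lambda>z. z / (1 - z)) F" and n: "n \<in> {1, 2, 3}"
  shows "log_inverse_coeff F n = (-1) ^ n / (2 * of_nat n)"
proof -
  have "(\<lambda>z. z / (1 - z)) \<in> normalized_analytic"
    using half_plane_map_convex by (simp add: convex_class_def)
  note \<Gamma> = log_inverse_coeff_formulas[OF this F half_plane_map_expansion]
  show ?thesis using n \<Gamma> by auto
qed

section \<open>The sharp bounds\<close>

lemma convex_class_log_inverse_coeff_bound:
  assumes f: "f \<in> convex_class" and F: "inverse_near_0 f F" and n: "n \<in> {1, 2, 3}"
  shows "norm (log_inverse_coeff F n) \<le> 1 / (2 * real n)"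
proof -
  have fn: "f \<in> normalized_analytic" using f by (simp add: convex_class_def)
  then have P: "f has_fps_expansion fps_expansion f 0"
    by (intro has_fps_expansion_fps_expansion[of "ball 0 1"]) (auto simp: normalized_analytic_def)
  obtain g G where g: "g holomorphic_on ball 0 1" "\<And>z. norm z < 1 \<Longrightarrow> norm (g z) \<le> 1"
    and G: "g has_fps_expansion G"
    and P2: "fps_nth (fps_expansion f 0) 2 = fps_nth G 0"
    and P3: "3 * fps_nth (fps_expansion f 0) 3 = fps_nth G 1 + 3 * fps_nth G 0 ^ 2"
    and P4: "6 * fps_nth (fps_expansion f 0) 4 =
      fps_nth G 2 + 5 * fps_nth G 0 * fps_nth G 1 + 6 * fps_nth G 0 ^ 3"
    using convex_class_coeffs[OF f P] by blast
  note \<Gamma> = log_inverse_coeff_formulas[OF fn F P]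
  have "log_inverse_coeff F 1 = - fps_nth G 0 / 2"
    using \<Gamma>(1) P2 by simp
  moreover have "norm (fps_nth G 0) \<le> 1"
    using schur_parameters[OF g G] by blast
  ultimately have 1: "norm (log_inverse_coeff F 1) \<le> 1 / 2"
    by simp
  have "log_inverse_coeff F 2 = - (2 * fps_nth G 1 - 3 * fps_nth G 0 ^ 2) / 12"
    using \<Gamma>(2) P2 P3 by (simp add: field_simps) algebra
  then have "norm (log_inverse_coeff F 2) = norm (2 * fps_nth G 1 - 3 * fps_nth G 0 ^ 2) / 12"
    by (simp only: norm_divide norm_minus_cancel) simp
  then have 2: "norm (log_inverse_coeff F 2) \<le> 1 / 4"
    using schur_quadratic_functional_bound[OF g G] by simp
  have "log_inverse_coeff F 3 =
      - (2 * fps_nth G 0 ^ 3 - 3 * fps_nth G 0 * fps_nth G 1 + fps_nth G 2) / 12"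
    using \<Gamma>(3) P2 P3 P4 by (simp add: field_simps) algebra
  then have "norm (log_inverse_coeff F 3) =
      norm (2 * fps_nth G 0 ^ 3 - 3 * fps_nth G 0 * fps_nth G 1 + fps_nth G 2) / 12"
    by (simp only: norm_divide norm_minus_cancel) simp
  then have 3: "norm (log_inverse_coeff F 3) \<le> 1 / 6"
    using schur_cubic_functional_bound[OF g G] by simp
  show ?thesis using n 1 2 3 by auto
qed

theorem corollary14:
  shows "(\<forall>f \<in> convex_class. \<forall>F. inverse_near_0 f F \<longrightarrow>
            (\<forall>n \<in> {1, 2, 3}. norm (log_inverse_coeff F n) \<le> 1 / (2 * real n)))
       \<and> (\<lambda>z. z / (1 - z)) \<in> convex_class
       \<and> (\<exists>F. inverse_near_0 (\<lambda>z. z / (1 - z)) F)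
       \<and> (\<forall>F. inverse_near_0 (\<lambda>z. z / (1 - z)) F \<longrightarrow>
            (\<forall>n \<in> {1, 2, 3}. norm (log_inverse_coeff F n) = 1 / (2 * real n)))"
proof (intro conjI ballI allI impI)
  show "\<exists>F. inverse_near_0 (\<lambda>z. z / (1 - z)) F"
    using half_plane_map_convex by (intro inverse_near_0_exists) (simp add: convex_class_def)
  show "norm (log_inverse_coeff F n) = 1 / (2 * real n)"
    if "inverse_near_0 (\<lambda>z. z / (1 - z)) F" "n \<in> {1, 2, 3}" for F n
    using log_inverse_coeff_half_plane_map[OF that] by (simp add: norm_divide norm_mult norm_power)
qed (use half_plane_map_convex convex_class_log_inverse_coeff_bound in auto)

end
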